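(* For every real number $s \geq 1$, $$\Gamma\left(\frac{1}{2s}\right) = \sqrt{\frac{\pi_{2s} \cdot \Gamma\left(\frac{1}{s}\right) \cdot 2s}{2^{1/s}}}.$$
   Context: $\Gamma$ denotes the Euler Gamma function. For real $s \geq 1$ define $$\pi_s := 2 \int_0^1 \frac{1}{\sqrt{1-x^s}}\, dx$$ (a convergent improper integral). *)

theory Defs
  imports "HOL-Analysis.Analysis"
begin

(* The Henstock-Kurzweil integral over the closed interval agrees with the improper
   integral (limit of the integrals over {0..c} as c tends to 1 from the left);
   the junk value 1 / 0 = 0 at the single point x = 1 is irrelevant. *)
definition gen_pi :: "real \<Rightarrow> real" where
  "gen_pi s = 2 * integral {0..1} (\<lambda>x. 1 / sqrt (1 - x powr s))"

end

theory Submission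
  imports Defs
begin

text \<open>
  The substitution \<open>t = x powr p\<close> turns Euler's Beta integral with parameters \<open>1 / p\<close> and \<open>b\<close> into
  \<open>p\<close> times the integral of \<open>(1 - x powr p) powr (b - 1)\<close>, because the exponent \<open>1 / p - 1\<close> of
  \<open>t\<close> is exactly the one that cancels the derivative of \<open>x powr p\<close> up to the factor \<open>p\<close>.
  For \<open>b = 1 / 2\<close> this is the integral defining \<open>gen_pi p\<close>, so that
  \<open>gen_pi p = 2 * Beta (1 / p) (1 / 2) / p\<close>.

  Put \<open>p = 2 * s\<close> and \<open>a = 1 / p\<close>. Then \<open>gen_pi p * p = 2 * Gamma a * sqrt pi / Gamma (a + 1 / 2)\<close>,
  and the Legendre duplication formula says that the remaining factor
  \<open>Gamma (2 * a) / 2 powr (2 * a)\<close> of the radicand is \<open>Gamma a * Gamma (a + 1 / 2) / (2 * sqrt pi)\<close>.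
  The radicand is therefore the square of \<open>Gamma a\<close>, which is positive.
\<close>

lemma powr_image_unit_interval:
  fixes p :: real
  assumes "p > 0"
  shows "(\<lambda>x. x powr p) ` {0<..<1} = {0<..<1}"
proof (intro equalityI subsetI)
  fix y assume "y \<in> (\<lambda>x. x powr p) ` {0<..<1}"
  then obtain x where x: "0 < x" "x < 1" "y = x powr p"
    by auto
  have "x powr p < 1 powr p"
    using x assms by (intro powr_less_mono2) auto
  with x show "y \<in> {0<..<1}"
    by simp
next
  fix y :: real assume y: "y \<in> {0<..<1}"
  have "y powr (1 / p) < 1 powr (1 / p)"
    using y assms by (intro powr_less_mono2) auto
  moreover have "y = (y powr (1 / p)) powr p"
    using y assms by (simp add: powr_powr)
  ultimately show "y \<in> (\<lambda>x. x powr p) ` {0<..<1}"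
    using y by (intro image_eqI[of _ _ "y powr (1 / p)"]) auto
qed

text \<open>
  Over the open interval the substitution function is differentiable and injective even for
  \<open>p < 1\<close>, and the possible singularities of both integrands sit at the discarded end points.
\<close>
lemma has_integral_one_minus_powr_powr:
  fixes p b :: real
  assumes p: "p > 0" and b: "b > 0"
  shows "((\<lambda>x. (1 - x powr p) powr (b - 1)) has_integral Beta (1 / p) b / p) {0..1}"
proof -
  let ?f = "\<lambda>t::real. t powr (1 / p - 1) * (1 - t) powr (b - 1)"
  let ?h = "\<lambda>x::real. (1 - x powr p) powr (b - 1)"
  let ?S = "{0<..<1::real}"
  have f: "(?f has_integral Beta (1 / p) b) ?S"
    using has_integral_Beta_real[of "1 / p" b] p b by (simp add: has_integral_Icc_iff_Ioo)
  then have "?f absolutely_integrable_on ?S"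
    by (intro nonnegative_absolutely_integrable_1) auto
  with f have "?f absolutely_integrable_on (\<lambda>x. x powr p) ` ?S \<and>
      integral ((\<lambda>x. x powr p) ` ?S) ?f = Beta (1 / p) b"
    by (simp add: powr_image_unit_interval[OF p] integral_unique)
  moreover have "inj_on (\<lambda>x. x powr p) ?S"
    by (rule inj_on_inverseI[of _ "\<lambda>y. y powr (1 / p)"]) (use p in \<open>simp add: powr_powr\<close>)
  moreover have "((\<lambda>x. x powr p) has_field_derivative p * x powr (p - 1)) (at x within ?S)"
    if "x \<in> ?S" for x
    using that by (auto intro!: derivative_eq_intros)
  ultimately have subst:
    "(\<lambda>x. \<bar>p * x powr (p - 1)\<bar> * ?f (x powr p)) absolutely_integrable_on ?S \<and>
      integral ?S (\<lambda>x. \<bar>p * x powr (p - 1)\<bar> * ?f (x powr p)) = Beta (1 / p) b"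
    by (subst has_absolute_integral_change_of_variables_1') auto
  have cancel: "\<bar>p * x powr (p - 1)\<bar> * ?f (x powr p) = p * ?h x" if "x \<in> ?S" for x
  proof -
    have "x powr (p - 1) * (x powr p) powr (1 / p - 1) = x powr ((p - 1) + p * (1 / p - 1))"
      by (simp only: powr_powr powr_add)
    also have "(p - 1) + p * (1 / p - 1) = 0"
      using p by (simp add: field_simps)
    finally show ?thesis
      using p that by (simp add: abs_mult)
  qed
  have "((\<lambda>x. \<bar>p * x powr (p - 1)\<bar> * ?f (x powr p)) has_integral Beta (1 / p) b) ?S"
    using integrable_integral[OF set_lebesgue_integral_eq_integral(1)[OF conjunct1[OF subst]]]
    by (simp only: conjunct2[OF subst])
  then have "((\<lambda>x. p * ?h x) has_integral Beta (1 / p) b) ?S"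
    by (rule has_integral_eq[rotated]) (rule cancel)
  from has_integral_mult_right[OF this, of "1 / p"] show ?thesis
    using p by (simp add: has_integral_Icc_iff_Ioo)
qed

lemma gen_pi_eq_Beta:
  assumes "p > 0"
  shows "gen_pi p = 2 * Beta (1 / p) (1 / 2) / p"
proof -
  have "1 / sqrt (1 - x powr p) = (1 - x powr p) powr (1 / 2 - 1)" if "x \<in> {0..1}" for x
  proof -
    have "x powr p \<le> 1"
      using that assms by (simp add: powr_le1)
    then show ?thesis
      using powr_minus_divide[of "1 - x powr p" "1 / 2"] by (simp add: powr_half_sqrt)
  qed
  then have "integral {0..1} (\<lambda>x. 1 / sqrt (1 - x powr p)) =
      integral {0..1} (\<lambda>x. (1 - x powr p) powr (1 / 2 - 1))"
    by (rule integral_cong)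
  also have "\<dots> = Beta (1 / p) (1 / 2) / p"
    using has_integral_one_minus_powr_powr[of p "1 / 2"] assms by (simp add: integral_unique)
  finally show ?thesis
    by (simp add: gen_pi_def)
qed

lemma Gamma_legendre_duplication_real:
  fixes a :: real
  assumes "a > 0"
  shows "Gamma a * Gamma (a + 1 / 2) = 2 powr (1 - 2 * a) * sqrt pi * Gamma (2 * a)"
proof -
  have "complex_of_real a \<notin> \<int>\<^sub>\<le>\<^sub>0" "complex_of_real a + 1 / 2 \<notin> \<int>\<^sub>\<le>\<^sub>0"
    using assms by (auto elim!: nonpos_Ints_cases simp: complex_eq_iff)
  from Gamma_legendre_duplication[OF this]
  have "complex_of_real (Gamma a * Gamma (a + 1 / 2)) =
      complex_of_real (exp ((1 - 2 * a) * ln 2) * sqrt pi * Gamma (2 * a))"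
    by (simp flip: Gamma_complex_of_real exp_of_real)
  then show ?thesis
    by (simp only: of_real_eq_iff) (simp add: powr_def)
qed

theorem theorem5:
  fixes s :: real
  assumes "s \<ge> 1"
  shows "Gamma (1 / (2 * s)) =
    sqrt ((gen_pi (2 * s) * Gamma (1 / s) * (2 * s)) / (2 powr (1 / s)))"
proof -
  define a where "a = 1 / (2 * s)"
  have a: "a > 0" and s: "1 / s = 2 * a"
    using assms by (simp_all add: a_def)
  have pos: "Gamma a > 0" "Gamma (a + 1 / 2) > 0"
    using a by (auto intro: Gamma_real_pos)
  have gen_pi: "gen_pi (2 * s) * (2 * s) * Gamma (a + 1 / 2) = 2 * Gamma a * sqrt pi"
    using gen_pi_eq_Beta[of "2 * s"] assms pos
    by (simp add: Beta_def Gamma_one_half_real flip: a_def)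
  have duplication: "Gamma a * Gamma (a + 1 / 2) * 2 powr (2 * a) = 2 * sqrt pi * Gamma (2 * a)"
    using Gamma_legendre_duplication_real[OF a] by (simp add: powr_diff)
  have "gen_pi (2 * s) * Gamma (2 * a) * (2 * s) * Gamma (a + 1 / 2) =
      Gamma a * (2 * sqrt pi * Gamma (2 * a))"
    using gen_pi by (simp add: algebra_simps)
  also have "\<dots> = (Gamma a)\<^sup>2 * 2 powr (2 * a) * Gamma (a + 1 / 2)"
    by (subst duplication[symmetric]) (simp only: power2_eq_square mult_ac)
  finally have "gen_pi (2 * s) * Gamma (2 * a) * (2 * s) / 2 powr (2 * a) = (Gamma a)\<^sup>2"
    using pos by simp
  then show ?thesis
    using pos by (simp add: s flip: a_def)
qed

end
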